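(* Let $\mathfrak{L}$ be a solvable left Leibniz algebra (of arbitrary dimension) over a field $\mathbb{F}$. If $\mathfrak{a}$ is a finite-dimensional minimal ideal of $\mathfrak{L}$ such that $C_{\mathfrak{L}}^r(\mathfrak{a})=\mathfrak{a}$, then every extension of $\mathfrak{a}$ by $\mathfrak{L}/\mathfrak{a}$ splits and all complements of $\mathfrak{a}$ in $\mathfrak{L}$ are conjugate.
   Context: A left Leibniz algebra over a field $\mathbb{F}$ is an $\mathbb{F}$-vector space $\mathfrak{L}$ with a bilinear multiplication satisfying $x(yz)=(xy)z+y(xz)$ for all $x,y,z\in\mathfrak{L}$. Ideals are two-sided; a minimal ideal is a non-zero ideal containing no non-zero ideal of $\mathfrak{L}$ properly. $\mathfrak{L}$ is solvable if its derived series $\mathfrak{L}^{(0)}=\mathfrak{L}$, $\mathfrak{L}^{(i+1)}=\langle xy\mid x,y\in\mathfrak{L}^{(i)}\rangle_{\mathbb{F}}$ reaches $0$. For $S\subseteq\mathfrak{L}$, the right centralizer is $C_{\mathfrak{L}}^r(S):=\{x\in\mathfrak{L}\mid sx=0\text{ for all }s\in S\}$. A minimal ideal $\mathfrak{a}$ of a solvable Leibniz algebra is abelian ($\mathfrak{a}\mathfrak{a}=0$), so $\mathfrak{a}$ is an $\mathfrak{L}/\mathfrak{a}$-bimodule via $(x+\mathfrak{a})\cdot a=xa$, $a\cdot(x+\mathfrak{a})=ax$. An extension of $\mathfrak{a}$ by $\mathfrak{L}/\mathfrak{a}$ means a short exact sequence $0\to\mathfrak{a}\to\mathfrak{E}\to\mathfrak{L}/\mathfrak{a}\to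 0$ of left Leibniz algebras ($\mathfrak{a}$ abelian) inducing on $\mathfrak{a}$ this given $\mathfrak{L}/\mathfrak{a}$-bimodule structure; it splits if there is a subalgebra $\mathfrak{H}$ of $\mathfrak{E}$ with $\mathfrak{E}=\mathfrak{a}\oplus\mathfrak{H}$ as vector spaces. A complement of $\mathfrak{a}$ in $\mathfrak{L}$ is a subalgebra $\mathfrak{K}$ of $\mathfrak{L}$ with $\mathfrak{L}=\mathfrak{a}\oplus\mathfrak{K}$ as vector spaces. Two subalgebras $\mathfrak{K},\mathfrak{H}$ of $\mathfrak{L}$ are conjugate if there is $x\in\mathfrak{L}$ with $\exp(L_x)(\mathfrak{K})=\mathfrak{H}$, where $L_x(y)=xy$ and $\exp(D)=\mathrm{id}+D+\frac{1}{2}D^2+\frac{1}{3!}D^3+\cdots$, with $L_x$ satisfying the appropriate nilpotency condition depending on the ground field so that $\exp(L_x)$ is defined: $L_x$ nilpotent suffices in characteristic zero, and over an arbitrary field $L_x^2=0$ suffices, in which case $\exp(L_x)=\mathrm{id}+L_x$. *)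

theory Defs
  imports "HOL-Computational_Algebra.Computational_Algebra"
begin

text \<open>The underlying space of an algebra is a whole type of class \<^class>\<open>ab_group_add\<close> with an
  explicit scalar multiplication; no finiteness of dimension is assumed.\<close>

locale left_leibniz_algebra = vector_space scale
  for scale :: "'f::field \<Rightarrow> 'l::ab_group_add \<Rightarrow> 'l" (infixr \<open>*s\<close> 75) +
  fixes mult :: "'l \<Rightarrow> 'l \<Rightarrow> 'l" (infixl \<open>\<cdot>\<close> 70)
  assumes mult_add_left: "(x + y) \<cdot> z = x \<cdot> z + y \<cdot> z"
    and mult_add_right: "x \<cdot> (y + z) = x \<cdot> y + x \<cdot> z"
    and mult_scale_left: "(c *s x) \<cdot> y = c *s (x \<cdot> y)"
    and mult_scale_right: "x \<cdot> (c *s y) = c *s (x \<cdot> y)"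
    and left_leibniz: "x \<cdot> (y \<cdot> z) = (x \<cdot> y) \<cdot> z + y \<cdot> (x \<cdot> z)"
begin

definition subalgebra :: "'l set \<Rightarrow> bool" where
  "subalgebra K \<longleftrightarrow> subspace K \<and> (\<forall>x\<in>K. \<forall>y\<in>K. x \<cdot> y \<in> K)"

definition leibniz_ideal :: "'l set \<Rightarrow> bool" where
  "leibniz_ideal I \<longleftrightarrow> subspace I \<and> (\<forall>x. \<forall>a\<in>I. x \<cdot> a \<in> I \<and> a \<cdot> x \<in> I)"

definition minimal_ideal :: "'l set \<Rightarrow> bool" where
  "minimal_ideal I \<longleftrightarrow> leibniz_ideal I \<and> I \<noteq> {0} \<and>
     (\<forall>J. leibniz_ideal J \<and> J \<noteq> {0} \<and> J \<subseteq> I \<longrightarrow> J = I)"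

primrec derived :: "nat \<Rightarrow> 'l set" where
  "derived 0 = UNIV"
| "derived (Suc i) = span {x \<cdot> y | x y. x \<in> derived i \<and> y \<in> derived i}"

definition solvable :: bool where
  "solvable \<longleftrightarrow> (\<exists>n. derived n = {0})"

definition right_centralizer :: "'l set \<Rightarrow> 'l set" where
  "right_centralizer S = {x. \<forall>s\<in>S. s \<cdot> x = 0}"

definition finite_dim :: "'l set \<Rightarrow> bool" where
  "finite_dim V \<longleftrightarrow> (\<exists>B. finite B \<and> span B = V)"

definition is_complement :: "'l set \<Rightarrow> 'l set \<Rightarrow> bool" where
  "is_complement A K \<longleftrightarrow> subalgebra K \<and> A \<inter> K = {0} \<and> (\<forall>x. \<exists>a\<in>A. \<exists>k\<in>K. x = a + k)"

text \<open>The exponential of \<open>L_x\<close> is regarded as defined when \<open>L_x\<close> is nilpotent and the characteristic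
  is zero, or when the square of \<open>L_x\<close> is zero (arbitrary characteristic). The exponential series is
  summed over its finitely many non-vanishing terms.\<close>

definition exp_left_defined :: "'l \<Rightarrow> bool" where
  "exp_left_defined x \<longleftrightarrow>
     (CHAR('f) = 0 \<and> (\<exists>n. \<forall>y. ((\<cdot>) x ^^ n) y = 0)) \<or> (\<forall>y. x \<cdot> (x \<cdot> y) = 0)"

definition exp_left :: "'l \<Rightarrow> 'l \<Rightarrow> 'l" where
  "exp_left x y =
     (\<Sum>k | ((\<cdot>) x ^^ k) y \<noteq> 0. inverse (of_nat (fact k)) *s ((\<cdot>) x ^^ k) y)"

definition conjugate :: "'l set \<Rightarrow> 'l set \<Rightarrow> bool" where
  "conjugate K H \<longleftrightarrow> (\<exists>x. exp_left_defined x \<and> exp_left x ` K = H)"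

text \<open>The quotient by an ideal \<open>A\<close>: its elements are the cosets of \<open>A\<close>, and the operations take the
  union of the cosets obtained from all choices of representatives; these all coincide, as
  the lemmas below record.\<close>

definition coset :: "'l set \<Rightarrow> 'l \<Rightarrow> 'l set" where
  "coset A x = {x + a | a. a \<in> A}"

definition quot_carrier :: "'l set \<Rightarrow> 'l set set" where
  "quot_carrier A = range (coset A)"

definition quot_add :: "'l set \<Rightarrow> 'l set \<Rightarrow> 'l set \<Rightarrow> 'l set" where
  "quot_add A X Y = (\<Union>x\<in>X. \<Union>y\<in>Y. coset A (x + y))"

definition quot_scale :: "'l set \<Rightarrow> 'f \<Rightarrow> 'l set \<Rightarrow> 'l set" where
  "quot_scale A c X = (\<Union>x\<in>X. coset A (c *s x))"

definition quot_mult :: "'l set \<Rightarrow> 'l set \<Rightarrow> 'l set \<Rightarrow> 'l set" where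
  "quot_mult A X Y = (\<Union>x\<in>X. \<Union>y\<in>Y. coset A (x \<cdot> y))"

lemma coset_self: "leibniz_ideal A \<Longrightarrow> x \<in> coset A x"
  unfolding coset_def leibniz_ideal_def using subspace_0 by force

lemma coset_eqI:
  assumes "leibniz_ideal A" "x - y \<in> A"
  shows "coset A x = coset A y"
proof -
  have s: "subspace A" using assms(1) by (simp add: leibniz_ideal_def)
  have "x + a \<in> coset A y" if "a \<in> A" for a
    unfolding coset_def using subspace_add[OF s assms(2) that]
    by (auto intro!: exI[of _ "x - y + a"] simp: algebra_simps)
  moreover have "y + a \<in> coset A x" if "a \<in> A" for a
    unfolding coset_def using subspace_diff[OF s that assms(2)]
    by (auto intro!: exI[of _ "a - (x - y)"] simp: algebra_simps)
  ultimately show ?thesis unfolding coset_def[of A x] coset_def[of A y]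
    by (auto simp: coset_def)
qed

lemma quot_add_coset:
  assumes "leibniz_ideal A"
  shows "quot_add A (coset A x) (coset A y) = coset A (x + y)"
proof -
  have s: "subspace A" using assms by (simp add: leibniz_ideal_def)
  have "coset A (u + v) = coset A (x + y)" if uv: "u \<in> coset A x" "v \<in> coset A y" for u v
  proof (rule coset_eqI[OF assms])
    obtain a b where "u = x + a" "v = y + b" "a \<in> A" "b \<in> A" using uv by (auto simp: coset_def)
    then show "u + v - (x + y) \<in> A" using subspace_add[OF s] by (simp add: algebra_simps)
  qed
  then show ?thesis unfolding quot_add_def using coset_self[OF assms] by blast
qed

lemma quot_scale_coset:
  assumes "leibniz_ideal A"
  shows "quot_scale A c (coset A x) = coset A (c *s x)"
proof -
  have s: "subspace A" using assms by (simp add: leibniz_ideal_def)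
  have "coset A (c *s u) = coset A (c *s x)" if u: "u \<in> coset A x" for u
  proof (rule coset_eqI[OF assms])
    obtain a where "u = x + a" "a \<in> A" using u by (auto simp: coset_def)
    then show "c *s u - c *s x \<in> A" using subspace_scale[OF s] by (simp add: algebra_simps)
  qed
  then show ?thesis unfolding quot_scale_def using coset_self[OF assms] by blast
qed

lemma quot_mult_coset:
  assumes "leibniz_ideal A"
  shows "quot_mult A (coset A x) (coset A y) = coset A (x \<cdot> y)"
proof -
  have s: "subspace A" using assms by (simp add: leibniz_ideal_def)
  have "coset A (u \<cdot> v) = coset A (x \<cdot> y)" if uv: "u \<in> coset A x" "v \<in> coset A y" for u v
  proof (rule coset_eqI[OF assms])
    obtain a b where *: "u = x + a" "v = y + b" "a \<in> A" "b \<in> A" using uv by (auto simp: coset_def)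
    then have "x \<cdot> b \<in> A" "a \<cdot> y \<in> A" "a \<cdot> b \<in> A" using assms by (auto simp: leibniz_ideal_def)
    then have "x \<cdot> b + (a \<cdot> y + a \<cdot> b) \<in> A" using subspace_add[OF s] by blast
    then show "u \<cdot> v - x \<cdot> y \<in> A" using * by (simp add: mult_add_left mult_add_right algebra_simps)
  qed
  then show ?thesis unfolding quot_mult_def using coset_self[OF assms] by blast
qed

lemma exp_left_square_zero:
  assumes "\<And>y. x \<cdot> (x \<cdot> y) = 0"
  shows "exp_left x y = y + x \<cdot> y"
proof -
  have x0: "x \<cdot> 0 = 0" using mult_add_right[of x 0 0] by simp
  have z: "((\<cdot>) x ^^ k) y = 0" if "2 \<le> k" for k
    using that by (induction k rule: dec_induct) (simp_all add: numeral_2_eq_2 assms x0)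
  have "exp_left x y = (\<Sum>k<2. inverse (of_nat (fact k)) *s ((\<cdot>) x ^^ k) y)"
    unfolding exp_left_def using z by (intro sum.mono_neutral_left) (auto simp: not_less[symmetric])
  then show ?thesis by (simp add: numeral_2_eq_2)
qed

end

text \<open>A short exact sequence \<open>0 \<rightarrow> A \<rightarrow> E \<rightarrow> L/A \<rightarrow> 0\<close> of left Leibniz algebras inducing on the ideal
  \<open>A\<close> the bimodule structure \<open>(x + A) \<cdot> a = xa\<close>, \<open>a \<cdot> (x + A) = ax\<close>. Only the restriction of \<open>\<iota>\<close> to
  \<open>A\<close> matters.\<close>

locale leibniz_extension =
  L: left_leibniz_algebra scaleL multL + E: left_leibniz_algebra scaleE multE
  for scaleL :: "'f::field \<Rightarrow> 'l::ab_group_add \<Rightarrow> 'l" and multL :: "'l \<Rightarrow> 'l \<Rightarrow> 'l"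
    and scaleE :: "'f \<Rightarrow> 'e::ab_group_add \<Rightarrow> 'e" and multE :: "'e \<Rightarrow> 'e \<Rightarrow> 'e" +
  fixes A :: "'l set" and \<iota> :: "'l \<Rightarrow> 'e" and \<pi> :: "'e \<Rightarrow> 'l set"
  assumes ideal: "L.leibniz_ideal A"
    and \<iota>_add: "a \<in> A \<Longrightarrow> b \<in> A \<Longrightarrow> \<iota> (a + b) = \<iota> a + \<iota> b"
    and \<iota>_scale: "a \<in> A \<Longrightarrow> \<iota> (scaleL c a) = scaleE c (\<iota> a)"
    and \<iota>_mult: "a \<in> A \<Longrightarrow> b \<in> A \<Longrightarrow> \<iota> (multL a b) = multE (\<iota> a) (\<iota> b)"
    and \<iota>_inj: "inj_on \<iota> A"
    and \<pi>_add: "\<pi> (u + v) = L.quot_add A (\<pi> u) (\<pi> v)"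
    and \<pi>_scale: "\<pi> (scaleE c u) = L.quot_scale A c (\<pi> u)"
    and \<pi>_mult: "\<pi> (multE u v) = L.quot_mult A (\<pi> u) (\<pi> v)"
    and \<pi>_surj: "range \<pi> = L.quot_carrier A"
    and exact: "{u. \<pi> u = L.coset A 0} = \<iota> ` A"
    and left_action: "a \<in> A \<Longrightarrow> x \<in> \<pi> u \<Longrightarrow> multE u (\<iota> a) = \<iota> (multL x a)"
    and right_action: "a \<in> A \<Longrightarrow> x \<in> \<pi> u \<Longrightarrow> multE (\<iota> a) u = \<iota> (multL a x)"
begin

definition splits :: bool where
  "splits \<longleftrightarrow> (\<exists>H. E.is_complement (\<iota> ` A) H)"

end

end

theory Submission
  imports Defs
begin

text \<open>If \<open>A \<noteq> L\<close>, minimality forces \<open>xa = -ax\<close> on \<open>A\<close>, since the elements \<open>xa + ax\<close> span an ideal that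
  annihilates \<open>L\<close> from the left. Let \<open>D\<close> be the last term of the derived series that is not contained
  in \<open>A\<close>. The elements of \<open>D\<close> act on \<open>A\<close> by commuting operators, and for \<open>b \<in> D\<close> the Fitting null
  component of \<open>L_b\<close> on \<open>A\<close> is an ideal. If it were all of \<open>A\<close> for every \<open>b \<in> D\<close>, then \<open>D\<close> would have a
  common non-zero kernel in \<open>A\<close>, hence would annihilate \<open>A\<close> and lie in the centralizer \<open>A\<close>. So some \<open>b \<in> D\<close>
  acts bijectively on \<open>A\<close>, while \<open>L_b\<^sup>2\<close> maps \<open>L\<close> to \<open>A\<close>. For any lift \<open>e\<close> of \<open>b\<close> to an extension,
  \<open>ker L_e\<^sup>2\<close> is then a complement of \<open>A\<close>, and every complement containing \<open>e\<close> equals it. Given two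
  complements with representatives \<open>k, h\<close> of \<open>b + A\<close>, solve \<open>kc = k - h\<close> in \<open>A\<close>; then
  \<open>exp(L_c) = 1 + L_c\<close> is an automorphism mapping \<open>k\<close> to \<open>h\<close>.\<close>

context left_leibniz_algebra
begin

section \<open>Elementary consequences of bilinearity and the Leibniz rule\<close>

lemma mult_zero_left [simp]: "0 \<cdot> x = 0"
  using mult_add_left[of 0 0 x] by simp

lemma mult_zero_right [simp]: "x \<cdot> 0 = 0"
  using mult_add_right[of x 0 0] by simp

lemma mult_minus_left: "(- x) \<cdot> y = - (x \<cdot> y)"
  using mult_add_left[of x "- x" y] by (simp add: eq_neg_iff_add_eq_0 add.commute)

lemma mult_minus_right: "x \<cdot> (- y) = - (x \<cdot> y)"
  using mult_add_right[of x y "- y"] by (simp add: eq_neg_iff_add_eq_0 add.commute)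

lemma mult_diff_left: "(x - y) \<cdot> z = x \<cdot> z - y \<cdot> z"
  using mult_add_left[of x "- y" z] by (simp add: mult_minus_left)

lemma mult_diff_right: "x \<cdot> (y - z) = x \<cdot> y - x \<cdot> z"
  using mult_add_right[of x y "- z"] by (simp add: mult_minus_right)

lemma mult_mult: "(x \<cdot> y) \<cdot> z = x \<cdot> (y \<cdot> z) - y \<cdot> (x \<cdot> z)"
  using left_leibniz[of x y z] by (simp add: algebra_simps)

lemma linear_mult_left: "Vector_Spaces.linear (*s) (*s) ((\<cdot>) x)"
  by unfold_locales (simp_all add: mult_add_right mult_scale_right)

section \<open>Dimension inside a finite-dimensional subspace\<close>

lemma dim_strict_mono:
  assumes "finite_dim A" "subspace V" "subspace W" "V \<subset> W" "W \<subseteq> A"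
  shows "dim V < dim W"
proof -
  obtain S where S: "finite S" "span S = A" using assms(1) by (auto simp: finite_dim_def)
  obtain B where B: "B \<subseteq> V" "independent B" "V \<subseteq> span B" "card B = dim V"
    by (rule basis_exists)
  obtain C where C: "C \<subseteq> W" "independent C" "W \<subseteq> span C" "card C = dim W"
    by (rule basis_exists)
  obtain x where x: "x \<in> W" "x \<notin> V" using assms(4) by blast
  have "x \<notin> span B" using span_minimal[OF B(1) assms(2)] x by blast
  then have ind: "independent (insert x B)" "x \<notin> B"
    using B(2) independent_insertI span_base by blast+
  \<comment> \<open>An infinite \<open>C\<close> would have \<open>card C = 0\<close>; finiteness
    comes from the finite spanning set of \<open>A\<close>.\<close>
  have "finite C" using independent_span_bound[OF S(1) C(2)] C(1) S(2) assms(5) by blast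
  moreover have "insert x B \<subseteq> span C" using x B(1) assms(4) C(3) by blast
  ultimately have "finite (insert x B) \<and> card (insert x B) \<le> card C"
    by (intro independent_span_bound ind(1))
  then show ?thesis using B(4) C(4) ind(2) by auto
qed

text \<open>Injectivity carries a basis of \<open>A\<close> to an independent set of the same size,
  so the image cannot be a proper subspace of smaller dimension.\<close>

lemma finite_dim_inj_imp_surj:
  assumes fd: "finite_dim A" and sA: "subspace A"
    and f: "Vector_Spaces.linear (*s) (*s) f" "f ` A \<subseteq> A" "inj_on f A"
  shows "f ` A = A"
proof (rule ccontr)
  interpret f: Vector_Spaces.linear "(*s)" "(*s)" f by (rule f(1))
  assume "f ` A \<noteq> A"
  then have lt: "dim (f ` A) < dim A"
    using dim_strict_mono[OF fd f.subspace_image[OF sA] sA] f(2) by blast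
  obtain B where B: "B \<subseteq> A" "independent B" "A \<subseteq> span B" "card B = dim A"
    by (rule basis_exists)
  have spB: "span B = A" using B(1,3) span_minimal[OF B(1) sA] by blast
  have "independent (f ` B)"
    using f.independent_inj_on_image[OF B(2)] f(3) spB by simp
  then have "dim (f ` A) = card (f ` B)"
    using dim_unique[of "f ` B" "f ` A" "card (f ` B)"] B(1) spB f.span_image[of B] by auto
  also have "\<dots> = card B" using card_image inj_on_subset[OF f(3) B(1)] by blast
  finally show False using lt B(4) by simp
qed

section \<open>Derived series and minimal ideals\<close>

lemma derived_subspace: "subspace (derived n)"
  by (cases n) auto

lemma derived_mult: "x \<in> derived n \<Longrightarrow> y \<in> derived n \<Longrightarrow> x \<cdot> y \<in> derived (Suc n)"
  unfolding derived.simps by (rule span_base) blast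

text \<open>Induction works because \<open>(p q) y = p (q y) - q (p y)\<close>, and
  \<open>q y\<close>, \<open>p y\<close> stay in the preceding term.\<close>

lemma derived_mult_right: "x \<in> derived n \<Longrightarrow> x \<cdot> y \<in> derived n"
proof (induction n arbitrary: x y)
  case 0
  show ?case by simp
next
  case (Suc n)
  have "x \<in> span {x \<cdot> y | x y. x \<in> derived n \<and> y \<in> derived n}" using Suc.prems by simp
  then show ?case
  proof (induction rule: span_induct_alt)
    case base
    show ?case unfolding mult_zero_left by (rule subspace_0[OF derived_subspace])
  next
    case (step c u v)
    obtain p q where u: "u = p \<cdot> q" "p \<in> derived n" "q \<in> derived n" using step by blast
    have "p \<cdot> (q \<cdot> y) - q \<cdot> (p \<cdot> y) \<in> derived (Suc n)"
      by (intro subspace_diff[OF derived_subspace] derived_mult u Suc.IH)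
    then have "u \<cdot> y \<in> derived (Suc n)" by (simp only: u(1) mult_mult)
    then have "c *s (u \<cdot> y) + v \<cdot> y \<in> derived (Suc n)"
      by (intro subspace_add[OF derived_subspace] subspace_scale[OF derived_subspace] step.IH)
    then show ?case by (simp only: mult_add_left mult_scale_left)
  qed
qed

text \<open>The two alternatives are the cases \<open>M = {0}\<close> and \<open>M = A\<close> for
  the ideal \<open>M\<close> spanned by all \<open>x a + a x\<close>.\<close>

lemma minimal_ideal_symmetric_or_annihilating:
  assumes "minimal_ideal A"
  shows "(\<forall>x. \<forall>a\<in>A. a \<cdot> x = - (x \<cdot> a)) \<or> (\<forall>a\<in>A. \<forall>x. a \<cdot> x = 0)"
proof -
  have ide: "leibniz_ideal A" and sA: "subspace A"
    and A: "\<And>x a. a \<in> A \<Longrightarrow> x \<cdot> a \<in> A" "\<And>x a. a \<in> A \<Longrightarrow> a \<cdot> x \<in> A"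
    using assms by (auto simp: minimal_ideal_def leibniz_ideal_def)
  let ?G = "{x \<cdot> a + a \<cdot> x | x a. a \<in> A}"
  let ?M = "span ?G"
  have MA: "?M \<subseteq> A"
    by (rule span_minimal) (use A subspace_add[OF sA] sA in auto)
  have right: "u \<cdot> y = 0" if "u \<in> ?M" for u y
    using that
  proof (induction rule: span_induct_alt)
    case (step c g v)
    obtain x a where g: "g = x \<cdot> a + a \<cdot> x" using step by blast
    \<comment> \<open>\<open>L_(x a)\<close> and \<open>L_(a x)\<close> are opposite commutators of
      \<open>L_x\<close> and \<open>L_a\<close>, so they cancel.\<close>
    have "g \<cdot> y = 0" unfolding g mult_add_left mult_mult by simp
    then show ?case using step by (simp add: mult_add_left mult_scale_left)
  qed simp
  have left: "y \<cdot> u \<in> ?M" if "u \<in> ?M" for u y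
    using that
  proof (induction rule: span_induct_alt)
    case (step c u v)
    obtain x a where u: "u = x \<cdot> a + a \<cdot> x" "a \<in> A" using step by blast
    \<comment> \<open>Since \<open>L_y\<close> is a derivation, the result regroups into the
      generators for the pairs \<open>(y x, a)\<close> and \<open>(x, y a)\<close>.\<close>
    have "y \<cdot> u = ((y \<cdot> x) \<cdot> a + a \<cdot> (y \<cdot> x)) + (x \<cdot> (y \<cdot> a) + (y \<cdot> a) \<cdot> x)"
      unfolding u(1) mult_add_right left_leibniz[of y] by (simp add: algebra_simps)
    also have "\<dots> \<in> ?M" by (intro span_add span_base) (use u A in auto)
    finally show ?case using step by (simp add: mult_add_right mult_scale_right span_add span_scale)
  qed (simp add: span_zero)
  have "leibniz_ideal ?M"
    unfolding leibniz_ideal_def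
  proof (intro conjI allI ballI)
    fix x a assume a: "a \<in> ?M"
    show "x \<cdot> a \<in> ?M" by (rule left[OF a])
    show "a \<cdot> x \<in> ?M" unfolding right[OF a] by (rule span_zero)
  qed (rule subspace_span)
  then have "?M = {0} \<or> ?M = A" using assms MA unfolding minimal_ideal_def by blast
  then show ?thesis
  proof
    assume "?M = {0}"
    then have "x \<cdot> a + a \<cdot> x = 0" if "a \<in> A" for x a
      using that span_base[of "x \<cdot> a + a \<cdot> x" ?G] by blast
    then have "a \<cdot> x = - (x \<cdot> a)" if "a \<in> A" for x a
      using that by (metis minus_unique)
    then show ?thesis by blast
  next
    assume "?M = A"
    then show ?thesis using right by blast
  qed
qed

section \<open>Fitting null components and an element acting bijectively\<close>

lemma funpow_mult_closed: "m \<in> V \<Longrightarrow> (\<And>v. v \<in> V \<Longrightarrow> b \<cdot> v \<in> V) \<Longrightarrow> ((\<cdot>) b ^^ n) m \<in> V"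
  by (induction n) auto

lemma funpow_mult_zero [simp]: "((\<cdot>) b ^^ n) 0 = 0"
  by (induction n) auto

lemma funpow_mult_add: "((\<cdot>) b ^^ n) (u + v) = ((\<cdot>) b ^^ n) u + ((\<cdot>) b ^^ n) v"
  by (induction n) (auto simp: mult_add_right)

lemma funpow_mult_scale: "((\<cdot>) b ^^ n) (c *s u) = c *s ((\<cdot>) b ^^ n) u"
  by (induction n) (auto simp: mult_scale_right)

definition fitting_null :: "'l set \<Rightarrow> 'l \<Rightarrow> 'l set" where
  "fitting_null A b = {m \<in> A. \<exists>n. ((\<cdot>) b ^^ n) m = 0}"

lemma subspace_fitting_null:
  assumes "subspace A"
  shows "subspace (fitting_null A b)"
proof (rule subspaceI)
  show "0 \<in> fitting_null A b" using subspace_0[OF assms] by (simp add: fitting_null_def)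
next
  fix u v assume "u \<in> fitting_null A b" "v \<in> fitting_null A b"
  then obtain i j where *: "u \<in> A" "v \<in> A" "((\<cdot>) b ^^ i) u = 0" "((\<cdot>) b ^^ j) v = 0"
    by (auto simp: fitting_null_def)
  have "((\<cdot>) b ^^ (j + i)) u = 0" "((\<cdot>) b ^^ (i + j)) v = 0" using * by (simp_all add: funpow_add)
  then have "((\<cdot>) b ^^ (i + j)) (u + v) = 0" by (simp add: funpow_mult_add add.commute[of j i])
  then show "u + v \<in> fitting_null A b"
    using * subspace_add[OF assms] unfolding fitting_null_def by blast
next
  fix c u assume "u \<in> fitting_null A b"
  then obtain i where "u \<in> A" "((\<cdot>) b ^^ i) u = 0" by (auto simp: fitting_null_def)
  then have "c *s u \<in> A" "((\<cdot>) b ^^ i) (c *s u) = 0"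
    using subspace_scale[OF assms] by (simp_all add: funpow_mult_scale)
  then show "c *s u \<in> fitting_null A b" unfolding fitting_null_def by blast
qed

text \<open>In \<open>b (x m) = (b x) m + x (b m)\<close> the operator \<open>L_(b x)\<close>
  commutes with \<open>L_b\<close> on \<open>A\<close>, so the first term dies with
  \<open>m\<close>, while \<open>b m\<close> needs one power less than \<open>m\<close>.\<close>

lemma fitting_null_ideal:
  assumes ide: "leibniz_ideal A"
    and sym: "\<And>x a. a \<in> A \<Longrightarrow> a \<cdot> x = - (x \<cdot> a)"
    and comm: "\<And>x a. a \<in> A \<Longrightarrow> (b \<cdot> x) \<cdot> (b \<cdot> a) = b \<cdot> ((b \<cdot> x) \<cdot> a)"
  shows "leibniz_ideal (fitting_null A b)"
proof -
  have sA: "subspace A" and A: "\<And>x a. a \<in> A \<Longrightarrow> x \<cdot> a \<in> A"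
    using ide by (auto simp: leibniz_ideal_def)
  have c: "((\<cdot>) b ^^ n) ((b \<cdot> x) \<cdot> m) = (b \<cdot> x) \<cdot> ((\<cdot>) b ^^ n) m" if "m \<in> A" for n x m
    by (induction n) (simp_all add: comm funpow_mult_closed A that)
  \<comment> \<open>The extra power pays for the Leibniz expansion: one factor \<open>b\<close> is
    used up before the remaining ones act on \<open>m\<close>.\<close>
  have z: "((\<cdot>) b ^^ Suc n) (x \<cdot> m) = 0" if "m \<in> A" "((\<cdot>) b ^^ n) m = 0" for n x m
    using that
  proof (induction n arbitrary: m)
    case (Suc n)
    have "((\<cdot>) b ^^ Suc (Suc n)) (x \<cdot> m) = ((\<cdot>) b ^^ Suc n) (b \<cdot> (x \<cdot> m))"
      by (subst funpow_Suc_right) simp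
    also have "b \<cdot> (x \<cdot> m) = (b \<cdot> x) \<cdot> m + x \<cdot> (b \<cdot> m)" by (rule left_leibniz)
    also have "((\<cdot>) b ^^ Suc n) \<dots> = (b \<cdot> x) \<cdot> ((\<cdot>) b ^^ Suc n) m + ((\<cdot>) b ^^ Suc n) (x \<cdot> (b \<cdot> m))"
      by (simp only: funpow_mult_add c[OF Suc.prems(1)])
    also have "((\<cdot>) b ^^ Suc n) (x \<cdot> (b \<cdot> m)) = 0"
      by (rule Suc.IH) (use Suc.prems A in \<open>simp_all add: funpow_swap1\<close>)
    finally show ?case using Suc.prems(2) by simp
  qed simp
  have "x \<cdot> m \<in> fitting_null A b" if "m \<in> fitting_null A b" for x m
    using that z A unfolding fitting_null_def by blast
  moreover from this have "m \<cdot> x \<in> fitting_null A b" if "m \<in> fitting_null A b" for x m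
    using that sym subspace_neg[OF subspace_fitting_null[OF sA]]
    by (metis (no_types, lifting) fitting_null_def mem_Collect_eq)
  ultimately show ?thesis
    unfolding leibniz_ideal_def using subspace_fitting_null[OF sA] by blast
qed

text \<open>In a non-zero \<open>D\<close>-invariant subspace of least dimension, the kernel of each
  \<open>L_b\<close> is non-zero by nilpotency and invariant by commutation, hence
  everything.\<close>

lemma commuting_nilpotents_common_kernel:
  assumes fd: "finite_dim A" and sA: "subspace A" and nz: "A \<noteq> {0}"
    and inv: "\<And>d a. d \<in> D \<Longrightarrow> a \<in> A \<Longrightarrow> d \<cdot> a \<in> A"
    and comm: "\<And>b d a. b \<in> D \<Longrightarrow> d \<in> D \<Longrightarrow> a \<in> A \<Longrightarrow> b \<cdot> (d \<cdot> a) = d \<cdot> (b \<cdot> a)"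
    and nil: "\<And>d. d \<in> D \<Longrightarrow> fitting_null A d = A"
  obtains v where "v \<in> A" "v \<noteq> 0" "\<And>d. d \<in> D \<Longrightarrow> d \<cdot> v = 0"
proof -
  define P where "P V \<longleftrightarrow> subspace V \<and> V \<subseteq> A \<and> V \<noteq> {0} \<and> (\<forall>d\<in>D. \<forall>v\<in>V. d \<cdot> v \<in> V)" for V
  have "P A" using sA nz inv by (auto simp: P_def)
  then obtain V where V: "P V" "\<And>W. P W \<Longrightarrow> dim V \<le> dim W"
    using ex_has_least_nat[of P A dim] by blast
  have sV: "subspace V" "V \<subseteq> A" "V \<noteq> {0}" and invV: "\<And>d v. d \<in> D \<Longrightarrow> v \<in> V \<Longrightarrow> d \<cdot> v \<in> V"
    using V(1) by (auto simp: P_def)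
  obtain v where v: "v \<in> V" "v \<noteq> 0" using sV subspace_0 by blast
  have "b \<cdot> v = 0" if b: "b \<in> D" for b
  proof -
    let ?W = "{w \<in> V. b \<cdot> w = 0}"
    have sW: "subspace ?W"
      by (rule subspaceI)
        (use sV(1) in \<open>auto simp: subspace_0 subspace_add subspace_scale mult_add_right mult_scale_right\<close>)
    \<comment> \<open>The last non-vanishing \<open>L_b\<close>-iterate of \<open>v\<close>
      witnesses that \<open>?W\<close> is non-zero.\<close>
    define n where "n = (LEAST n. ((\<cdot>) b ^^ n) v = 0)"
    have ex: "\<exists>n. ((\<cdot>) b ^^ n) v = 0" using nil[OF b] v sV(2) by (auto simp: fitting_null_def)
    have n: "((\<cdot>) b ^^ n) v = 0" using LeastI_ex[OF ex] by (simp add: n_def)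
    then obtain k where k: "n = Suc k" using v(2) by (cases n) auto
    have "((\<cdot>) b ^^ k) v \<noteq> 0" using not_less_Least[of k "\<lambda>n. ((\<cdot>) b ^^ n) v = 0"] k by (simp add: n_def)
    moreover have "((\<cdot>) b ^^ k) v \<in> ?W" using n k funpow_mult_closed[OF v(1)] invV[OF b] by simp
    ultimately have "?W \<noteq> {0}" by blast
    moreover have "d \<cdot> w \<in> ?W" if "d \<in> D" "w \<in> ?W" for d w
      using comm[OF b that(1)] that invV sV(2) by auto
    ultimately have "P ?W" using sW sV(2) by (auto simp: P_def)
    then have "\<not> ?W \<subset> V" using V(2) dim_strict_mono[OF fd sW sV(1) _ sV(2)] by force
    then show ?thesis using v(1) by blast
  qed
  then show ?thesis using that v sV(2) by blast
qed

lemma exists_bijective_element: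
  assumes solv: "solvable" and min: "minimal_ideal A" and fd: "finite_dim A"
    and cent: "right_centralizer A = A"
    and sym: "\<And>x a. a \<in> A \<Longrightarrow> a \<cdot> x = - (x \<cdot> a)"
    and ne: "A \<noteq> UNIV"
  obtains b where "inj_on ((\<cdot>) b) A" "(\<cdot>) b ` A = A" "\<And>x. b \<cdot> (b \<cdot> x) \<in> A"
proof -
  have ide: "leibniz_ideal A" and sA: "subspace A" and nz: "A \<noteq> {0}"
    and A: "\<And>x a. a \<in> A \<Longrightarrow> x \<cdot> a \<in> A"
    and minA: "\<And>J. leibniz_ideal J \<Longrightarrow> J \<subseteq> A \<Longrightarrow> J = {0} \<or> J = A"
    using min by (auto simp: minimal_ideal_def leibniz_ideal_def)
  have AA: "a \<cdot> a' = 0" if "a \<in> A" "a' \<in> A" for a a'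
    using that cent by (auto simp: right_centralizer_def)
  obtain N where "derived N = {0}" using solv by (auto simp: solvable_def)
  then have "derived N \<subseteq> A" using subspace_0[OF sA] by simp
  \<comment> \<open>\<open>derived 0\<close> is the whole algebra, not contained in
    \<open>A\<close>, so the first index whose term lies in \<open>A\<close> is a successor.\<close>
  then obtain n where n: "\<not> derived n \<subseteq> A" "derived (Suc n) \<subseteq> A"
    using ex_least_nat_less[of "\<lambda>n. derived n \<subseteq> A" N] ne by auto
  define D where "D = derived n"
  have DD: "x \<cdot> y \<in> A" if "x \<in> D" "y \<in> D" for x y
    using that n(2) derived_mult by (auto simp: D_def)
  have DL: "x \<cdot> y \<in> D" if "x \<in> D" for x y
    using that derived_mult_right by (simp add: D_def)
  \<comment> \<open>The commutator of \<open>L_b\<close> and \<open>L_d\<close> is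
    \<open>L_(b d)\<close>, with \<open>b d\<close> in \<open>A\<close> and hence zero on
    \<open>A\<close>.\<close>
  have comm: "b \<cdot> (d \<cdot> a) = d \<cdot> (b \<cdot> a)" if "b \<in> D" "d \<in> D" "a \<in> A" for b d a
    using left_leibniz[of b d a] AA[OF DD[OF that(1,2)] that(3)] by simp
  have fit: "leibniz_ideal (fitting_null A b)" if "b \<in> D" for b
    using fitting_null_ideal[OF ide sym] comm DL that by metis
  have "\<exists>b\<in>D. fitting_null A b \<noteq> A"
  proof (rule ccontr)
    assume "\<not> ?thesis"
    then have nil: "fitting_null A d = A" if "d \<in> D" for d using that by blast
    obtain v where v: "v \<in> A" "v \<noteq> 0" "\<And>d. d \<in> D \<Longrightarrow> d \<cdot> v = 0"
    proof (rule commuting_nilpotents_common_kernel[OF fd sA nz, of D])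
      show "d \<cdot> a \<in> A" if "d \<in> D" "a \<in> A" for d a by (rule A[OF that(2)])
      show "b \<cdot> (d \<cdot> a) = d \<cdot> (b \<cdot> a)" if "b \<in> D" "d \<in> D" "a \<in> A" for b d a
        by (rule comm[OF that])
      show "fitting_null A d = A" if "d \<in> D" for d by (rule nil[OF that])
    qed (rule that)
    let ?Z = "{m \<in> A. \<forall>d\<in>D. d \<cdot> m = 0}"
    \<comment> \<open>\<open>d (x m) = (d x) m + x (d m)\<close>, where \<open>d x\<close> is again
      in \<open>D\<close>.\<close>
    have Z: "x \<cdot> m \<in> ?Z" if "m \<in> ?Z" for x m
      using that A DL by (auto simp: left_leibniz[of _ x])
    have sZ: "subspace ?Z"
      by (rule subspaceI)
        (use sA in \<open>auto simp: subspace_0 subspace_add subspace_scale mult_add_right mult_scale_right\<close>)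
    have "m \<cdot> x \<in> ?Z" if "m \<in> ?Z" for m x
      using subspace_neg[OF sZ Z[OF that, of x]] sym[of m x] that by simp
    then have "leibniz_ideal ?Z" using Z sZ unfolding leibniz_ideal_def by blast
    then have "?Z = A" using minA[of ?Z] v by blast
    \<comment> \<open>Now \<open>d a = 0\<close> for all \<open>d\<close> in \<open>D\<close> and
      \<open>a\<close> in \<open>A\<close>; \<open>sym\<close> turns this into
      \<open>a d = 0\<close>.\<close>
    then have "D \<subseteq> right_centralizer A" using sym by (force simp: right_centralizer_def)
    then show False using n(1) cent by (simp add: D_def)
  qed
  then obtain b where b: "b \<in> D" "fitting_null A b \<noteq> A" by blast
  then have "fitting_null A b = {0}"
    using minA[OF fit[OF b(1)]] by (auto simp: fitting_null_def)
  then have ker: "a = 0" if "a \<in> A" "b \<cdot> a = 0" for a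
  proof -
    have "((\<cdot>) b ^^ 1) a = 0" using that by simp
    then have "a \<in> fitting_null A b" using that(1) unfolding fitting_null_def by blast
    then show ?thesis using \<open>fitting_null A b = {0}\<close> by simp
  qed
  have inj: "inj_on ((\<cdot>) b) A"
  proof (rule inj_onI)
    fix x y assume "x \<in> A" "y \<in> A" "b \<cdot> x = b \<cdot> y"
    then show "x = y" using ker[of "x - y"] subspace_diff[OF sA] by (simp add: mult_diff_right)
  qed
  moreover have "(\<cdot>) b ` A = A"
    using finite_dim_inj_imp_surj[OF fd sA linear_mult_left _ inj] A by blast
  ultimately show ?thesis using that DD[OF b(1) DL[OF b(1)]] by blast
qed

section \<open>Complements as kernels of squares\<close>

lemma ker_square_subalgebra:
  assumes inj: "\<And>a. a \<in> A \<Longrightarrow> e \<cdot> a = 0 \<Longrightarrow> a = 0"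
    and sq: "\<And>u. e \<cdot> (e \<cdot> u) \<in> A"
  shows "subalgebra {u. e \<cdot> (e \<cdot> u) = 0}"
proof -
  have "e \<cdot> (e \<cdot> (u \<cdot> v)) = 0" if "e \<cdot> (e \<cdot> u) = 0" "e \<cdot> (e \<cdot> v) = 0" for u v
  \<comment> \<open>By the Leibniz rule \<open>e (e (u v))\<close> reduces to
    \<open>2 (e u) (e v)\<close>, which a third \<open>e\<close> annihilates; as it lies in
    \<open>A\<close>, injectivity makes it zero.\<close>
  proof (rule inj[OF sq])
    show "e \<cdot> (e \<cdot> (e \<cdot> (u \<cdot> v))) = 0"
      by (simp add: left_leibniz[of e u v] left_leibniz[of e "e \<cdot> u" v]
          left_leibniz[of e u "e \<cdot> v"] left_leibniz[of e "e \<cdot> u" "e \<cdot> v"] mult_add_right that)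
  qed
  moreover have "subspace {u. e \<cdot> (e \<cdot> u) = 0}"
    by (rule subspaceI) (auto simp: mult_add_right mult_scale_right)
  ultimately show ?thesis by (simp add: subalgebra_def)
qed

lemma ker_square_complement:
  assumes sA: "subspace A" and bij: "inj_on ((\<cdot>) e) A" "(\<cdot>) e ` A = A"
    and sq: "\<And>u. e \<cdot> (e \<cdot> u) \<in> A"
  shows "is_complement A {u. e \<cdot> (e \<cdot> u) = 0}"
proof -
  have inj: "a = 0" if "a \<in> A" "e \<cdot> a = 0" for a
    using inj_onD[OF bij(1), of a 0] that subspace_0[OF sA] by simp
  have eA: "e \<cdot> a \<in> A" if "a \<in> A" for a using bij(2) that by blast
  have "\<exists>a\<in>A. \<exists>k\<in>{u. e \<cdot> (e \<cdot> u) = 0}. x = a + k" for x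
  proof -
    \<comment> \<open>Since \<open>e\<close> maps \<open>A\<close> onto itself, so does its square;
      then \<open>x - a\<close> is in the kernel.\<close>
    obtain a where a: "a \<in> A" "e \<cdot> (e \<cdot> x) = e \<cdot> (e \<cdot> a)" using sq[of x] bij(2) by (metis imageE)
    then show ?thesis by (intro bexI[of _ a] bexI[of _ "x - a"]) (auto simp: mult_diff_right)
  qed
  moreover have "A \<inter> {u. e \<cdot> (e \<cdot> u) = 0} = {0}"
    using inj eA subspace_0[OF sA] by auto
  ultimately show ?thesis
    unfolding is_complement_def using ker_square_subalgebra[OF inj sq] by blast
qed

text \<open>For \<open>k\<close> in \<open>K\<close>, \<open>e (e k)\<close> lies in both
  \<open>A\<close> and \<open>K\<close>, so it is zero; conversely, the \<open>A\<close>-component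
  of a kernel element is annihilated by the injective square of \<open>e\<close>.\<close>

lemma complement_eq_ker_square:
  assumes K: "is_complement A K" "e \<in> K"
    and inj: "\<And>a. a \<in> A \<Longrightarrow> e \<cdot> a = 0 \<Longrightarrow> a = 0" and eA: "\<And>a. a \<in> A \<Longrightarrow> e \<cdot> a \<in> A"
    and sq: "\<And>u. e \<cdot> (e \<cdot> u) \<in> A"
  shows "K = {u. e \<cdot> (e \<cdot> u) = 0}"
proof -
  have *: "A \<inter> K = {0}" "\<And>x y. x \<in> K \<Longrightarrow> y \<in> K \<Longrightarrow> x \<cdot> y \<in> K"
    using K by (auto simp: is_complement_def subalgebra_def)
  have z: "e \<cdot> (e \<cdot> k) = 0" if "k \<in> K" for k
    using *(1) *(2)[OF K(2) *(2)[OF K(2) that]] sq[of k] by blast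
  have "u \<in> K" if u: "e \<cdot> (e \<cdot> u) = 0" for u
  proof -
    obtain a k where ak: "a \<in> A" "k \<in> K" "u = a + k" using K(1) unfolding is_complement_def by blast
    have "e \<cdot> (e \<cdot> a) = 0" using u z[OF ak(2)] by (simp add: ak(3) mult_add_right)
    then have "a = 0" using inj eA ak(1) by blast
    then show ?thesis using ak by simp
  qed
  then show ?thesis using z by blast
qed

section \<open>Conjugacy of complements\<close>

lemma exp_left_conjugates_complements:
  assumes ide: "leibniz_ideal A"
    and AA: "\<And>a a'. a \<in> A \<Longrightarrow> a' \<in> A \<Longrightarrow> a \<cdot> a' = 0"
    and sym: "\<And>x a. a \<in> A \<Longrightarrow> a \<cdot> x = - (x \<cdot> a)"
    and bij: "inj_on ((\<cdot>) b) A" "(\<cdot>) b ` A = A" and sq: "\<And>x. b \<cdot> (b \<cdot> x) \<in> A"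
    and K: "is_complement A K" and H: "is_complement A H"
  shows "conjugate K H"
proof -
  have sA: "subspace A" and A: "\<And>x a. a \<in> A \<Longrightarrow> x \<cdot> a \<in> A" "\<And>x a. a \<in> A \<Longrightarrow> a \<cdot> x \<in> A"
    using ide by (auto simp: leibniz_ideal_def)
  obtain p k where k: "p \<in> A" "k \<in> K" "b = p + k" using K unfolding is_complement_def by blast
  obtain q h where h: "q \<in> A" "h \<in> H" "b = q + h" using H unfolding is_complement_def by blast
  \<comment> \<open>\<open>k\<close> and \<open>h\<close> differ from \<open>b\<close> by elements
    of \<open>A\<close>, so they inherit its action on \<open>A\<close>.\<close>
  have act: "e \<cdot> a = b \<cdot> a" if "b = r + e" "r \<in> A" "a \<in> A" for r e a
    using AA[of r a] that by (simp add: mult_add_left)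
  have sq': "e \<cdot> (e \<cdot> x) \<in> A" if "b = r + e" "r \<in> A" for r e x
  proof -
    have e: "e = b - r" using that by simp
    show ?thesis unfolding e mult_diff_left mult_diff_right
      by (intro subspace_diff[OF sA] sq A that)
  qed
  have inj: "a = 0" if "b = r + e" "r \<in> A" "a \<in> A" "e \<cdot> a = 0" for r e a
    using inj_onD[OF bij(1), of a 0] act[OF that(1-3)] that subspace_0[OF sA] by simp
  have KK: "K = {u. k \<cdot> (k \<cdot> u) = 0}"
    using complement_eq_ker_square[OF K k(2) inj[OF k(3,1)] A(1) sq'[OF k(3,1)]] .
  have HH: "H = {u. h \<cdot> (h \<cdot> u) = 0}"
    using complement_eq_ker_square[OF H h(2) inj[OF h(3,1)] A(1) sq'[OF h(3,1)]] .
  have "k - h = q - p" using k(3) h(3) by (simp add: algebra_simps)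
  then have "k - h \<in> A" using subspace_diff[OF sA h(1) k(1)] by simp
  then obtain c where c: "c \<in> A" "b \<cdot> c = k - h" using bij(2) by (metis imageE)
  \<comment> \<open>Thus \<open>exp(L_c)\<close> sends \<open>k\<close> to
    \<open>k + c k = h\<close>.\<close>
  then have ck: "c \<cdot> k = h - k" using sym[OF c(1)] act[OF k(3,1) c(1)] by simp
  have c2: "c \<cdot> (c \<cdot> y) = 0" for y using AA c(1) A(2) by blast
  have ex: "exp_left c = (\<lambda>y. y + c \<cdot> y)" using exp_left_square_zero[OF c2] by blast
  \<comment> \<open>\<open>1 + L_c\<close> is multiplicative because \<open>L_c\<close> is a derivation and \<open>(cx)(cy) \<in> AA = 0\<close>.\<close>
  have hom: "h \<cdot> (y + c \<cdot> y) = k \<cdot> y + c \<cdot> (k \<cdot> y)" for y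
  proof -
    have "h = k + c \<cdot> k" using ck by simp
    moreover have "(c \<cdot> k) \<cdot> (c \<cdot> y) = 0" using AA A(2) c(1) by blast
    ultimately show ?thesis by (simp add: mult_add_left mult_add_right left_leibniz[of c k y])
  qed
  have hom2: "h \<cdot> (h \<cdot> (y + c \<cdot> y)) = k \<cdot> (k \<cdot> y) + c \<cdot> (k \<cdot> (k \<cdot> y))" for y by (simp only: hom)
  \<comment> \<open>By \<open>hom2\<close>, \<open>exp(L_c)\<close> carries \<open>k (k y)\<close>
    to \<open>h (h (exp_left c y))\<close>; being injective, it matches the two kernels.\<close>
  have sub: "exp_left c y \<in> H \<longleftrightarrow> y \<in> K" for y
  proof -
    define u where "u = k \<cdot> (k \<cdot> y)"
    have "u = 0" if u: "u + c \<cdot> u = 0"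
    proof -
      have "c \<cdot> u = c \<cdot> (u + c \<cdot> u)" by (simp only: mult_add_right c2 add_0_right)
      then have "c \<cdot> u = 0" unfolding u by simp
      then show ?thesis using u by simp
    qed
    then have "u + c \<cdot> u = 0 \<longleftrightarrow> u = 0" by auto
    then show ?thesis unfolding KK HH ex u_def by (simp only: mem_Collect_eq hom2)
  qed
  \<comment> \<open>\<open>1 - L_c\<close> inverts \<open>1 + L_c\<close>, giving surjectivity onto
    \<open>H\<close>.\<close>
  have "exp_left c (y - c \<cdot> y) = y" for y by (simp add: ex mult_diff_right c2)
  then have "exp_left c ` K = H" using sub by (metis image_eqI subsetI imageE subset_antisym)
  moreover have "exp_left_defined c" using c2 by (simp add: exp_left_defined_def)
  ultimately show ?thesis unfolding conjugate_def by blast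
qed

lemma complement_UNIV: "is_complement UNIV K \<longleftrightarrow> K = {0}"
  unfolding is_complement_def subalgebra_def by auto

lemma conjugate_refl: "conjugate K K"
proof -
  have "exp_left 0 y = y" for y using exp_left_square_zero[of 0 y] by simp
  then show ?thesis unfolding conjugate_def
    by (intro exI[of _ 0]) (simp add: exp_left_defined_def)
qed

end

section \<open>Splitting of extensions\<close>

context leibniz_extension
begin

lemma \<pi>_coset: obtains x where "\<pi> u = L.coset A x"
  using \<pi>_surj unfolding L.quot_carrier_def by blast

lemma subspace_image: "E.subspace (\<iota> ` A)"
proof -
  have sA: "L.subspace A" using ideal by (simp add: L.leibniz_ideal_def)
  have "\<iota> 0 = 0" using \<iota>_add[of 0 0] L.subspace_0[OF sA] by simp
  then show ?thesis
    by (intro E.subspaceI)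
      (use L.subspace_0[OF sA] L.subspace_add[OF sA] L.subspace_scale[OF sA] in
        \<open>force simp flip: \<iota>_add \<iota>_scale\<close>)+
qed

lemma splits_if_bijective_element:
  assumes bij: "inj_on (multL b) A" "multL b ` A = A" and sq: "\<And>x. multL b (multL b x) \<in> A"
  shows splits
proof -
  have "L.coset A b \<in> range \<pi>" unfolding \<pi>_surj L.quot_carrier_def by blast
  then obtain e where e: "\<pi> e = L.coset A b" by (metis imageE)
  \<comment> \<open>\<open>b\<close> is a representative of \<open>\<pi> e\<close>, so
    \<open>e\<close> acts on the image of \<open>A\<close> as \<open>b\<close> does on
    \<open>A\<close>.\<close>
  have act: "multE e (\<iota> a) = \<iota> (multL b a)" if "a \<in> A" for a
    using left_action[OF that] e L.coset_self[OF ideal] by simp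
  have "inj_on (\<lambda>a. multE e (\<iota> a)) A \<longleftrightarrow> inj_on (\<iota> \<circ> multL b) A"
    by (rule inj_on_cong) (simp add: act)
  moreover have "inj_on (\<iota> \<circ> multL b) A" using comp_inj_on[OF bij(1)] bij(2) \<iota>_inj by simp
  ultimately have "inj_on (multE e) (\<iota> ` A)" using inj_on_imageI[of "multE e" \<iota> A] by (simp add: comp_def)
  moreover have "multE e ` \<iota> ` A = \<iota> ` A"
  proof -
    have "multE e ` \<iota> ` A = \<iota> ` multL b ` A" unfolding image_image using act by simp
    then show ?thesis using bij(2) by simp
  qed
  moreover have "multE e (multE e u) \<in> \<iota> ` A" for u
  proof -
    obtain x where "\<pi> u = L.coset A x" by (rule \<pi>_coset)
    \<comment> \<open>Exactness reduces membership in the image of \<open>A\<close> to the quotient,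
      where \<open>b (b x)\<close> vanishes.\<close>
    then have "\<pi> (multE e (multE e u)) = L.coset A (multL b (multL b x))"
      by (simp add: \<pi>_mult e L.quot_mult_coset[OF ideal])
    also have "\<dots> = L.coset A 0" by (rule L.coset_eqI[OF ideal]) (simp add: sq)
    finally show ?thesis using exact by blast
  qed
  ultimately show ?thesis
    unfolding splits_def using E.ker_square_complement[OF subspace_image] by blast
qed

lemma splits_if_UNIV:
  assumes "A = UNIV"
  shows splits
proof -
  have "\<pi> u = L.coset A 0" for u
  proof -
    obtain x where "\<pi> u = L.coset A x" by (rule \<pi>_coset)
    then show ?thesis using L.coset_eqI[OF ideal, of x 0] assms by simp
  qed
  then have "\<iota> ` A = UNIV" using exact by blast
  then show ?thesis unfolding splits_def using E.complement_UNIV by metis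
qed

end

theorem theorem5p4:
  fixes scaleL :: "'f::field \<Rightarrow> 'l::ab_group_add \<Rightarrow> 'l"
    and multL :: "'l \<Rightarrow> 'l \<Rightarrow> 'l"
    and A :: "'l set"
  assumes "left_leibniz_algebra scaleL multL"
    and "left_leibniz_algebra.solvable scaleL multL"
    and "left_leibniz_algebra.minimal_ideal scaleL multL A"
    and "left_leibniz_algebra.finite_dim scaleL A"
    and "left_leibniz_algebra.right_centralizer multL A = A"
  shows "(\<forall>(scaleE :: 'f \<Rightarrow> 'e::ab_group_add \<Rightarrow> 'e) multE \<iota> \<pi>.
            leibniz_extension scaleL multL scaleE multE A \<iota> \<pi> \<longrightarrow>
            leibniz_extension.splits scaleE multE A \<iota>) \<and>
         (\<forall>K H. left_leibniz_algebra.is_complement scaleL multL A K \<and>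
                left_leibniz_algebra.is_complement scaleL multL A H \<longrightarrow>
                left_leibniz_algebra.conjugate scaleL multL K H)"
proof -
  interpret L: left_leibniz_algebra scaleL multL by (rule assms(1))
  show ?thesis
  proof (cases "A = UNIV")
    \<comment> \<open>The centralizer condition makes the algebra abelian, so no element acts
      bijectively on \<open>A\<close>. The quotient is zero, and \<open>{0}\<close> is the only
      complement.\<close>
    case True
    then show ?thesis
      by (auto simp: L.complement_UNIV L.conjugate_refl intro: leibniz_extension.splits_if_UNIV)
  next
    case False
    have AA: "multL a a' = 0" if "a \<in> A" "a' \<in> A" for a a'
      using that assms(5) by (auto simp: L.right_centralizer_def)
    \<comment> \<open>The annihilating alternative would put every element into the right
      centralizer, forcing \<open>A = UNIV\<close>.\<close>
    have sym: "multL a x = - multL x a" if "a \<in> A" for a x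
      using L.minimal_ideal_symmetric_or_annihilating[OF assms(3)] that False assms(5)
      by (auto simp: L.right_centralizer_def)
    obtain b where b: "inj_on (multL b) A" "multL b ` A = A" "\<And>x. multL b (multL b x) \<in> A"
      using L.exists_bijective_element[OF assms(2-5) sym False] by blast
    have "L.leibniz_ideal A" using assms(3) by (simp add: L.minimal_ideal_def)
    then have conj: "L.conjugate K H" if "L.is_complement A K" "L.is_complement A H" for K H
      using L.exp_left_conjugates_complements[OF _ AA sym b] that by blast
    show ?thesis
    proof (intro conjI allI impI)
      fix scaleE :: "'f \<Rightarrow> 'e \<Rightarrow> 'e" and multE \<iota> \<pi>
      assume "leibniz_extension scaleL multL scaleE multE A \<iota> \<pi>"
      then interpret leibniz_extension scaleL multL scaleE multE A \<iota> \<pi> .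
      show splits by (rule splits_if_bijective_element) (fact b)+
    qed (use conj in blast)
  qed
qed

end
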